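(* Let $m,n$ be positive integers. For every matrix $(a_{ij})\in\mathbb{R}^{m\times n}$ there exists a unique polynomial $p\in\mathcal{P}_m^n$ such that $p(i,j)=a_{ij}$ for all $(i,j)\in\{1,\ldots,m\}\times\{1,\ldots,n\}$, and it is given by $$p(x,y)=\sum_{k=1}^{m}\left(\prod_{\alpha=1,\,\alpha\neq k}^{m}\frac{x-\alpha}{k-\alpha}\right)p_k(y),$$ where $$p_k(y)=\sum_{r=1}^{n}\left(\prod_{\alpha=1,\,\alpha\neq r}^{n}\frac{y-\alpha}{r-\alpha}\right)a_{kr}\quad\text{for all }k=1,2,\ldots,m.$$
   Context: $\mathcal{P}_m^n$ denotes the tensor product space $\Pi_{m-1}\otimes\Pi_{n-1}$ of bivariate real polynomials, i.e. the set of all polynomials of the form $p(x,y)=\sum_{k_1=0}^{m-1}\sum_{k_2=0}^{n-1}\lambda_{k_1,k_2}x^{k_1}y^{k_2}$ with $\lambda_{k_1,k_2}\in\mathbb{R}$. *)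

theory Defs
  imports Complex_Main "HOL-Computational_Algebra.Polynomial"
begin

text \<open>
  A bivariate real polynomial is an element of \<open>\<real>[y][x]\<close>, i.e. of type \<^typ>\<open>real poly poly\<close>:
  the outer indeterminate is \<open>x\<close>, and its coefficients are polynomials in \<open>y\<close>.
  Hence \<open>monom (monom c k2) k1\<close> is the monomial \<open>c x^k1 y^k2\<close>.
\<close>

definition poly_xy :: "real poly poly \<Rightarrow> real \<Rightarrow> real \<Rightarrow> real" where
  "poly_xy p x y = poly (poly p [:x:]) y"

text \<open>
  The space \<open>\<Pi>\<^sub>m\<^sub>-\<^sub>1 \<otimes> \<Pi>\<^sub>n\<^sub>-\<^sub>1\<close>; the exponents \<open>0, \<dots>, m - 1\<close> and \<open>0, \<dots>, n - 1\<close> are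
  written \<open>k1 < m\<close> and \<open>k2 < n\<close>.
\<close>

definition tensor_poly_space :: "nat \<Rightarrow> nat \<Rightarrow> real poly poly set" where
  "tensor_poly_space m n =
     {p. \<exists>c :: nat \<Rightarrow> nat \<Rightarrow> real. p = (\<Sum>k1<m. \<Sum>k2<n. monom (monom (c k1 k2) k2) k1)}"

end

theory Submission
  imports Defs
begin

text \<open>
  Univariate Lagrange interpolation, applied first in \<open>x\<close> for fixed \<open>y\<close> and then in \<open>y\<close> at each
  node \<open>x = k\<close>, shows that a polynomial of the tensor product space is the stated combination of
  its values on the grid. This is the formula, and it implies uniqueness because a bivariate
  polynomial over an infinite field is determined by its values. For existence, the coefficient
  of \<open>x^k1 y^k2\<close> is read off the products of the univariate Lagrange basis polynomials.
\<close>

text \<open>Division by the constant \<open>t k - t \<alpha>\<close> is encoded as scaling by its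
  inverse, so that each factor is a linear polynomial.\<close>

definition lagrange_basis :: "('i \<Rightarrow> 'a::field) \<Rightarrow> 'i set \<Rightarrow> 'i \<Rightarrow> 'a poly" where
  "lagrange_basis t I k = (\<Prod>\<alpha>\<in>I - {k}. smult (inverse (t k - t \<alpha>)) [:- t \<alpha>, 1:])"

lemma poly_lagrange_basis:
  "poly (lagrange_basis t I k) x = (\<Prod>\<alpha>\<in>I - {k}. (x - t \<alpha>) / (t k - t \<alpha>))"
  unfolding lagrange_basis_def poly_prod
  by (intro prod.cong refl) (simp add: divide_inverse algebra_simps)

lemma poly_lagrange_basis_node:
  assumes "finite I" "inj_on t I" "i \<in> I" "k \<in> I"
  shows "poly (lagrange_basis t I k) (t i) = (if i = k then 1 else 0)"
proof (cases "i = k")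
  case True
  have "(\<Prod>\<alpha>\<in>I - {k}. (t k - t \<alpha>) / (t k - t \<alpha>)) = 1"
    using assms by (intro prod.neutral) (auto dest: inj_onD)
  with True show ?thesis by (simp add: poly_lagrange_basis)
next
  case False
  then show ?thesis
    using assms by (auto simp: poly_lagrange_basis intro!: prod_zero)
qed

text \<open>There are \<open>card I - 1\<close> factors, each of degree at most 1; membership of
  \<open>k\<close> in \<open>I\<close> is what makes the bound strict.\<close>

lemma degree_lagrange_basis:
  assumes "finite I" "k \<in> I"
  shows "degree (lagrange_basis t I k) < card I"
proof -
  have "degree (lagrange_basis t I k)
          \<le> (\<Sum>\<alpha>\<in>I - {k}. degree (smult (inverse (t k - t \<alpha>)) [:- t \<alpha>, 1:]))"
    unfolding lagrange_basis_def using assms(1)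
    by (intro degree_prod_sum_le[unfolded o_def]) simp
  also have "\<dots> \<le> (\<Sum>\<alpha>\<in>I - {k}. 1)"
    by (intro sum_mono) simp
  also have "\<dots> < card I"
    using assms card_gt_0_iff[of I] by auto
  finally show ?thesis .
qed

lemma lagrange_interpolation:
  assumes "finite I" "inj_on t I" "degree q < card I"
  shows "poly q x = (\<Sum>k\<in>I. poly (lagrange_basis t I k) x * poly q (t k))"
proof -
  define r where "r = (\<Sum>k\<in>I. smult (poly q (t k)) (lagrange_basis t I k))"
  have "q = r"
  proof (rule poly_eqI_degree[where A = "t ` I"])
    show "poly q y = poly r y" if y: "y \<in> t ` I" for y
    proof -
      from y obtain i where i: "i \<in> I" "y = t i" by blast
      have "poly r y = (\<Sum>k\<in>I. if i = k then poly q (t k) else 0)"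
        unfolding r_def i(2) poly_sum
        by (intro sum.cong refl)
          (use assms i poly_lagrange_basis_node[of I t i] in auto)
      also have "\<dots> = poly q y"
        using assms(1) i by simp
      finally show ?thesis by simp
    qed
    show "card (t ` I) > degree q"
      using assms by (simp add: card_image)
    have "degree r < card I"
      unfolding r_def
    proof (rule degree_sum_less)
      show "degree (smult (poly q (t k)) (lagrange_basis t I k)) < card I" if "k \<in> I" for k
        by (rule le_less_trans[OF degree_smult_le degree_lagrange_basis[OF assms(1) that]])
    qed (use assms(3) in simp)
    then show "card (t ` I) > degree r"
      using assms by (simp add: card_image)
  qed
  then have "poly q x = poly r x" by simp
  also have "\<dots> = (\<Sum>k\<in>I. poly (lagrange_basis t I k) x * poly q (t k))"
    by (simp add: r_def poly_sum mult.commute)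
  finally show ?thesis .
qed

text \<open>The coefficients beyond the degree vanish. A summation range common to all basis
  polynomials is what later allows the sums to be exchanged.\<close>

lemma poly_as_sum_lessThan:
  fixes p :: "'a::comm_semiring_1 poly"
  assumes "degree p < n"
  shows "poly p x = (\<Sum>i<n. coeff p i * x ^ i)"
proof -
  have "(\<Sum>i\<le>degree p. coeff p i * x ^ i) = (\<Sum>i<n. coeff p i * x ^ i)"
    using assms by (intro sum.mono_neutral_left) (auto simp: coeff_eq_0)
  then show ?thesis by (simp add: poly_altdef)
qed

lemma poly_xy_sum_monom:
  "poly_xy (\<Sum>k1<m. \<Sum>k2<n. monom (monom (c k1 k2) k2) k1) x y
     = (\<Sum>k1<m. \<Sum>k2<n. c k1 k2 * y ^ k2 * x ^ k1)"
  by (simp add: poly_xy_def poly_sum poly_monom poly_const_pow mult.commute)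

text \<open>For each real \<open>x\<close>, equal values at all \<open>y\<close> make the
  polynomials \<open>poly p [:x:]\<close> and \<open>poly q [:x:]\<close> equal. Hence every
  constant polynomial \<open>[:x:]\<close> is a root of \<open>p - q\<close>, and a nonzero
  polynomial over the integral domain of real polynomials has only finitely many roots.\<close>

lemma poly_xy_eqI:
  assumes "\<And>x y. poly_xy p x y = poly_xy q x y"
  shows "p = q"
proof (rule ccontr)
  assume "p \<noteq> q"
  then have "finite {z. poly (p - q) z = 0}"
    by (intro poly_roots_finite) simp
  moreover have "poly p [:x:] = poly q [:x:]" for x
    by (rule poly_eq_poly_eq_iff[THEN iffD1], rule ext) (rule assms[unfolded poly_xy_def])
  then have "range (\<lambda>x. [:x:]) \<subseteq> {z. poly (p - q) z = 0}"
    by auto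
  ultimately have "finite (range (\<lambda>x::real. [:x:]))"
    by (rule finite_subset[rotated])
  moreover have "inj (\<lambda>x::real. [:x:])"
    by (simp add: inj_def)
  ultimately show False
    using finite_imageD infinite_UNIV_char_0 by blast
qed

lemma tensor_poly_space_section_x:
  assumes "p \<in> tensor_poly_space m n" "m \<ge> 1"
  obtains q where "degree q < m" "\<And>x. poly_xy p x y = poly q x"
proof -
  from assms(1) obtain c where
    p: "p = (\<Sum>k1<m. \<Sum>k2<n. monom (monom (c k1 k2) k2) k1)"
    unfolding tensor_poly_space_def by blast
  show thesis
  proof
    \<comment> \<open>The witness collects the double sum by powers of \<open>x\<close>, with the
      value of \<open>y\<close> absorbed into the coefficients.\<close>
    show "degree (\<Sum>k1<m. monom (\<Sum>k2<n. c k1 k2 * y ^ k2) k1) < m"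
      using assms(2)
      by (intro degree_sum_less) (auto intro: le_less_trans[OF degree_monom_le])
    show "poly_xy p x y = poly (\<Sum>k1<m. monom (\<Sum>k2<n. c k1 k2 * y ^ k2) k1) x" for x
      by (simp add: p poly_xy_sum_monom poly_sum poly_monom sum_distrib_right)
  qed
qed

lemma tensor_poly_space_section_y:
  assumes "p \<in> tensor_poly_space m n" "n \<ge> 1"
  obtains q where "degree q < n" "\<And>y. poly_xy p x y = poly q y"
proof -
  from assms(1) obtain c where
    p: "p = (\<Sum>k1<m. \<Sum>k2<n. monom (monom (c k1 k2) k2) k1)"
    unfolding tensor_poly_space_def by blast
  show thesis
  proof
    show "degree (\<Sum>k2<n. monom (\<Sum>k1<m. c k1 k2 * x ^ k1) k2) < n"
      using assms(2)
      by (intro degree_sum_less) (auto intro: le_less_trans[OF degree_monom_le])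
    show "poly_xy p x y = poly (\<Sum>k2<n. monom (\<Sum>k1<m. c k1 k2 * x ^ k1) k2) y" for y
      unfolding p poly_xy_sum_monom
      \<comment> \<open>The outer sum runs over the powers of \<open>x\<close>; exchanging the two
        sums collects the powers of \<open>y\<close> instead.\<close>
      by (subst sum.swap) (simp add: poly_sum poly_monom sum_distrib_left mult_ac)
  qed
qed

lemma tensor_lagrange_interpolation:
  assumes p: "p \<in> tensor_poly_space (card I) (card J)"
    and I: "finite I" "I \<noteq> {}" "inj_on s I"
    and J: "finite J" "J \<noteq> {}" "inj_on t J"
  shows "poly_xy p x y = (\<Sum>k\<in>I. poly (lagrange_basis s I k) x *
           (\<Sum>r\<in>J. poly (lagrange_basis t J r) y * poly_xy p (s k) (t r)))"
proof -
  have card: "card I \<ge> 1" "card J \<ge> 1"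
    using I J by (simp_all add: Suc_le_eq card_gt_0_iff)
  obtain q where q: "degree q < card I" "\<And>x. poly_xy p x y = poly q x"
    using tensor_poly_space_section_x[OF p card(1)] by blast
  have y: "poly_xy p (s k) y
      = (\<Sum>r\<in>J. poly (lagrange_basis t J r) y * poly_xy p (s k) (t r))" for k
  proof -
    obtain q where q: "degree q < card J" "\<And>y. poly_xy p (s k) y = poly q y"
      using tensor_poly_space_section_y[OF p card(2)] by blast
    show ?thesis
      unfolding q(2) by (rule lagrange_interpolation[OF J(1,3) q(1)])
  qed
  have "poly_xy p x y = (\<Sum>k\<in>I. poly (lagrange_basis s I k) x * poly_xy p (s k) y)"
    unfolding q(2) by (rule lagrange_interpolation[OF I(1,3) q(1)])
  then show ?thesis
    by (simp add: y)
qed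

lemma tensor_lagrange_exists:
  assumes I: "finite I" and J: "finite J"
  obtains p where "p \<in> tensor_poly_space (card I) (card J)"
    "\<And>x y. poly_xy p x y = (\<Sum>k\<in>I. poly (lagrange_basis s I k) x *
           (\<Sum>r\<in>J. poly (lagrange_basis t J r) y * a k r))"
proof
  define c where "c k1 k2 = (\<Sum>k\<in>I. \<Sum>r\<in>J.
    coeff (lagrange_basis s I k) k1 * (coeff (lagrange_basis t J r) k2 * a k r))" for k1 k2
  let ?p = "\<Sum>k1<card I. \<Sum>k2<card J. monom (monom (c k1 k2) k2) k1"
  show "?p \<in> tensor_poly_space (card I) (card J)"
    unfolding tensor_poly_space_def by blast
  show "poly_xy ?p x y = (\<Sum>k\<in>I. poly (lagrange_basis s I k) x *
           (\<Sum>r\<in>J. poly (lagrange_basis t J r) y * a k r))" for x y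
  proof -
    \<comment> \<open>The factors are grouped into an \<open>x\<close> part depending on
      \<open>k1\<close> and \<open>k\<close> and a \<open>y\<close> part depending on
      \<open>k2\<close> and \<open>r\<close>. The exchanges below move each of \<open>k1\<close> and
      \<open>k2\<close> inside its node index, so that the basis polynomials reappear as inner
      sums.\<close>
    let ?F = "\<lambda>k1 k2 k r. coeff (lagrange_basis s I k) k1 * x ^ k1 *
           (coeff (lagrange_basis t J r) k2 * y ^ k2 * a k r)"
    have "poly_xy ?p x y = (\<Sum>k1<card I. \<Sum>k2<card J. \<Sum>k\<in>I. \<Sum>r\<in>J. ?F k1 k2 k r)"
      by (simp add: poly_xy_sum_monom c_def sum_distrib_left sum_distrib_right mult_ac)
    also have "\<dots> = (\<Sum>k1<card I. \<Sum>k\<in>I. \<Sum>k2<card J. \<Sum>r\<in>J. ?F k1 k2 k r)"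
      by (rule sum.cong[OF refl sum.swap])
    also have "\<dots> = (\<Sum>k\<in>I. \<Sum>k1<card I. \<Sum>k2<card J. \<Sum>r\<in>J. ?F k1 k2 k r)"
      by (rule sum.swap)
    also have "\<dots> = (\<Sum>k\<in>I. \<Sum>k1<card I. \<Sum>r\<in>J. \<Sum>k2<card J. ?F k1 k2 k r)"
      by (rule sum.cong[OF refl], rule sum.cong[OF refl], rule sum.swap)
    also have "\<dots> = (\<Sum>k\<in>I. (\<Sum>k1<card I. coeff (lagrange_basis s I k) k1 * x ^ k1) *
        (\<Sum>r\<in>J. (\<Sum>k2<card J. coeff (lagrange_basis t J r) k2 * y ^ k2) * a k r))"
      \<comment> \<open>Multiplying out the left factor first puts \<open>k1\<close> outside
        \<open>r\<close> and \<open>k2\<close>, which is the order of the sums reached so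
        far.\<close>
      by (simp only: sum_distrib_right, simp only: sum_distrib_left)
    also have "\<dots> = (\<Sum>k\<in>I. poly (lagrange_basis s I k) x *
        (\<Sum>r\<in>J. poly (lagrange_basis t J r) y * a k r))"
      by (simp add: poly_as_sum_lessThan[OF degree_lagrange_basis[OF I]]
          poly_as_sum_lessThan[OF degree_lagrange_basis[OF J]])
    finally show ?thesis .
  qed
qed

theorem corollary3p7:
  fixes m n :: nat and a :: "nat \<Rightarrow> nat \<Rightarrow> real"
  assumes "m \<ge> 1" and "n \<ge> 1"
  shows "(\<exists>!p. p \<in> tensor_poly_space m n \<and>
              (\<forall>i\<in>{1..m}. \<forall>j\<in>{1..n}. poly_xy p (real i) (real j) = a i j)) \<and>
         (\<forall>p. p \<in> tensor_poly_space m n \<and>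
              (\<forall>i\<in>{1..m}. \<forall>j\<in>{1..n}. poly_xy p (real i) (real j) = a i j) \<longrightarrow>
              (let pk = (\<lambda>(k::nat) (y::real).
                     \<Sum>r\<in>{1..n}. (\<Prod>\<alpha>\<in>{1..n} - {r}. (y - real \<alpha>) / (real r - real \<alpha>)) * a k r)
               in \<forall>x y. poly_xy p x y =
                     (\<Sum>k\<in>{1..m}. (\<Prod>\<alpha>\<in>{1..m} - {k}. (x - real \<alpha>) / (real k - real \<alpha>)) * pk k y)))"
proof -
  let ?P = "\<lambda>p. p \<in> tensor_poly_space m n \<and>
              (\<forall>i\<in>{1..m}. \<forall>j\<in>{1..n}. poly_xy p (real i) (real j) = a i j)"
  let ?L = "\<lambda>N. lagrange_basis real {1..N}"
  let ?R = "\<lambda>x y. \<Sum>k\<in>{1..m}. poly (?L m k) x * (\<Sum>r\<in>{1..n}. poly (?L n r) y * a k r)"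
  have formula: "poly_xy p x y = ?R x y" if "?P p" for p x y
  proof -
    have "poly_xy p x y = (\<Sum>k\<in>{1..m}. poly (?L m k) x *
        (\<Sum>r\<in>{1..n}. poly (?L n r) y * poly_xy p (real k) (real r)))"
      by (rule tensor_lagrange_interpolation) (use that assms in \<open>auto simp: inj_on_def\<close>)
    also have "\<dots> = ?R x y"
      using that by (intro sum.cong refl arg_cong2[where f = "(*)"]) auto
    finally show ?thesis .
  qed
  obtain p where p: "p \<in> tensor_poly_space m n" "\<And>x y. poly_xy p x y = ?R x y"
    using tensor_lagrange_exists[of "{1..m}" "{1..n}" real real a] by auto
  have node: "poly (?L N k) (real i) = (if i = k then 1 else 0)"
    if "i \<in> {1..N}" "k \<in> {1..N}" for N i k
    using that by (intro poly_lagrange_basis_node) (auto simp: inj_on_def)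
  \<comment> \<open>At a grid point the basis values are Kronecker deltas: the inner sum collapses
    to \<open>r = j\<close>, then the outer one to \<open>k = i\<close>.\<close>
  have "poly_xy p (real i) (real j) = a i j" if ij: "i \<in> {1..m}" "j \<in> {1..n}" for i j
  proof -
    have inner: "(\<Sum>r\<in>{1..n}. poly (?L n r) (real j) * a k r) = a k j" for k
    proof -
      have "(\<Sum>r\<in>{1..n}. poly (?L n r) (real j) * a k r)
          = (\<Sum>r\<in>{1..n}. if j = r then a k r else 0)"
        by (intro sum.cong refl) (simp add: node[OF ij(2)] del: One_nat_def)
      then show ?thesis using ij by simp
    qed
    have "poly_xy p (real i) (real j) = (\<Sum>k\<in>{1..m}. if i = k then a k j else 0)"
      unfolding p(2) inner by (intro sum.cong refl) (simp add: node[OF ij(1)] del: One_nat_def)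
    then show ?thesis using ij by simp
  qed
  with p(1) have "?P p" by blast
  \<comment> \<open>\<open>?R\<close> depends only on the data \<open>a\<close>, so every solution
    takes the same values as \<open>p\<close> at all real points.\<close>
  moreover have "q = p" if "?P q" for q
    by (rule poly_xy_eqI) (simp only: formula[OF that] p(2))
  ultimately have "\<exists>!p. ?P p" by blast
  \<comment> \<open>Evaluating the basis polynomials turns \<open>?R\<close> into the products of
    quotients in the statement.\<close>
  then show ?thesis
    using formula by (simp add: Let_def poly_lagrange_basis)
qed

end
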